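(* Let $I$ and $J$ be two skew-symmetric $(1,1)$-tensors on a pre-Courant algebroid $(E,\Theta)$ such that $\mathcal{T}_\Theta I(JX,Y)=\mathcal{T}_\Theta I(X,JY)=0$ for all sections $X$ and $Y$ of $E$. If $(I,J)$ is a compatible pair w.r.t. $\Theta$, then, for all $k,n\in\mathbb{N}$, $C_{\Theta_k}(I,I^n\circ J)=0$ and $(I,I^n\circ J)$ is a compatible pair w.r.t. $\Theta_k$.
   Context: $E\to M$ is a real vector bundle over a smooth manifold with a fibrewise non-degenerate symmetric bilinear form $\langle\cdot,\cdot\rangle$. A pre-Courant structure $\Theta$ on it is a pair $(\rho,[\cdot,\cdot])$, where $\rho:E\to TM$ is a bundle map and $[\cdot,\cdot]$ is an $\mathbb{R}$-bilinear, not necessarily skew-symmetric, bracket on $\Gamma(E)$ such that, for all $X,Y,Z\in\Gamma(E)$, $\rho(X)\cdot\langle Y,Z\rangle=\langle[X,Y],Z\rangle+\langle Y,[X,Z]\rangle$ and $\rho(X)\cdot\langle Y,Z\rangle=\langle X,[Y,Z]+[Z,Y]\rangle$. Then $(E,\Theta)$ is a pre-Courant algebroid. Sums and scalar multiples of pre-Courant structures are taken componentwise. A $(1,1)$-tensor is a vector bundle endomorphism of $E$ over $\mathrm{id}_M$; $J$ is skew-symmetric if $\langle Ju,v\rangle+\langle u,Jv\rangle=0$. For $J$ skew-symmetric, $\Theta_J=(\rho\circ J,[\cdot,\cdot]_J)$ with $[X,Y]_J=[JX,Y]+[X,JY]-J[X,Y]$, which is again a pre-Courant structure. Write $\Theta_{I,J}=(\Theta_I)_J$.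 $\Theta_0=\Theta$ and $\Theta_k=(\Theta_{k-1})_I$ ($k$ successive deformations by $I$). $I^n$ is the $n$-fold composition, $I^0=\mathrm{id}_E$. $\mathbb{N}$ includes $0$. The torsion of $I$ is $\mathcal{T}_\Theta I(X,Y)=[IX,IY]-I([X,Y]_I)$. The concomitant of skew-symmetric $I,J$ is $C_\Theta(I,J)=\Theta_{I,J}+\Theta_{J,I}$. $(I,J)$ is a compatible pair w.r.t. $\Theta$ if $I$ and $J$ are skew-symmetric, $I\circ J=-J\circ I$ and $C_\Theta(I,J)=0$. *)

theory Defs
  imports "HOL-Analysis.Analysis"
begin

section \<open>Smooth functions on open subsets of Euclidean space\<close>

text \<open>
  Euclidean n-space is the library's \<^const>\<open>Euclidean_space\<close> n, whose points are the functions
  from nat to real vanishing at all indices from n on. In this way the dimension of a manifold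
  and the rank of a bundle are arbitrary natural numbers, including 0.
\<close>

primrec Ck_on :: "nat \<Rightarrow> nat \<Rightarrow> (nat \<Rightarrow> real) set \<Rightarrow> ((nat \<Rightarrow> real) \<Rightarrow> real) \<Rightarrow> bool" where
  "Ck_on 0 n V f \<longleftrightarrow> continuous_map (subtopology (Euclidean_space n) V) euclideanreal f"
| "Ck_on (Suc k) n V f \<longleftrightarrow>
     continuous_map (subtopology (Euclidean_space n) V) euclideanreal f \<and>
     (\<forall>i<n. \<exists>D. (\<forall>x\<in>V. ((\<lambda>t. f (x(i := t))) has_real_derivative D x) (at (x i))) \<and>
                Ck_on k n V D)"

definition smooth_on_Rn :: "nat \<Rightarrow> (nat \<Rightarrow> real) set \<Rightarrow> ((nat \<Rightarrow> real) \<Rightarrow> real) \<Rightarrow> bool" where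
  "smooth_on_Rn n V f \<longleftrightarrow> (\<forall>k. Ck_on k n V f)"

definition partial_deriv :: "nat \<Rightarrow> ((nat \<Rightarrow> real) \<Rightarrow> real) \<Rightarrow> (nat \<Rightarrow> real) \<Rightarrow> real" where
  "partial_deriv i f x = deriv (\<lambda>t. f (x(i := t))) (x i)"


section \<open>Smooth manifolds\<close>

text \<open>
  The underlying topological space of a manifold is a type; the atlas is a set of pairs of a
  chart domain and a chart map. The values of a chart map outside its domain are irrelevant.
\<close>

record 'm manifold =
  mdim :: nat
  atlas :: "('m set \<times> ('m \<Rightarrow> nat \<Rightarrow> real)) set"

definition smooth_manifold :: "'m::{t2_space,second_countable_topology} manifold \<Rightarrow> bool" where
  "smooth_manifold M \<longleftrightarrow>
     (\<Union>(U, \<phi>)\<in>atlas M. U) = UNIV \<and>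
     (\<forall>(U, \<phi>)\<in>atlas M.
        open U \<and> openin (Euclidean_space (mdim M)) (\<phi> ` U) \<and>
        homeomorphic_map (top_of_set U) (subtopology (Euclidean_space (mdim M)) (\<phi> ` U)) \<phi>) \<and>
     (\<forall>(U, \<phi>)\<in>atlas M. \<forall>(V, \<psi>)\<in>atlas M. \<forall>i<mdim M.
        smooth_on_Rn (mdim M) (\<phi> ` (U \<inter> V)) (\<lambda>y. \<psi> (inv_into U \<phi> y) i))"

definition smooth_fun_on :: "'m manifold \<Rightarrow> 'm set \<Rightarrow> ('m \<Rightarrow> real) \<Rightarrow> bool" where
  "smooth_fun_on M W f \<longleftrightarrow>
     (\<forall>(U, \<phi>)\<in>atlas M. smooth_on_Rn (mdim M) (\<phi> ` (U \<inter> W)) (\<lambda>y. f (inv_into U \<phi> y)))"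

definition smooth_funs :: "'m manifold \<Rightarrow> ('m \<Rightarrow> real) set" where
  "smooth_funs M = {f. smooth_fun_on M UNIV f}"

text \<open>
  Tangent vectors at x are the derivations at x of the algebra of smooth functions. As HOL
  functions are total, a tangent vector is given the value 0 on functions that are not smooth,
  so that equality of tangent vectors is equality of HOL functions.
\<close>

definition tangent_space :: "'m manifold \<Rightarrow> 'm \<Rightarrow> (('m \<Rightarrow> real) \<Rightarrow> real) set" where
  "tangent_space M x =
     {D. (\<forall>f. f \<notin> smooth_funs M \<longrightarrow> D f = 0) \<and>
         (\<forall>f\<in>smooth_funs M. \<forall>h\<in>smooth_funs M. \<forall>a b.
            D (\<lambda>y. a * f y + b * h y) = a * D f + b * D h) \<and>
         (\<forall>f\<in>smooth_funs M. \<forall>h\<in>smooth_funs M.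
            D (\<lambda>y. f y * h y) = D f * h x + f x * D h)}"


section \<open>Vector bundles\<close>

text \<open>
  The fibres are linear subspaces of one ambient real vector space, without any topology or
  smooth structure. This is no restriction, since every family of vector spaces embeds
  fibrewise in its direct sum. The total space is the disjoint union of the fibres, with the
  smooth structure determined by the local trivialisations, which identify the fibres over
  their domains linearly with Euclidean space and have smooth transition matrices.
\<close>

record ('m, 'e) vbundle =
  brank :: nat
  fibre :: "'m \<Rightarrow> 'e set"
  trivs :: "('m set \<times> ('m \<Rightarrow> 'e \<Rightarrow> nat \<Rightarrow> real)) set"

text \<open>The j-th vector at x of the local frame given by a trivialisation.\<close>

definition frame ::
  "('m, 'e) vbundle \<Rightarrow> ('m \<Rightarrow> 'e \<Rightarrow> nat \<Rightarrow> real) \<Rightarrow> nat \<Rightarrow> 'm \<Rightarrow> 'e" where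
  "frame E \<tau> j x = inv_into (fibre E x) (\<tau> x) (\<lambda>i. if i = j then 1 else 0)"

definition vector_bundle ::
  "'m::topological_space manifold \<Rightarrow> ('m, 'e::real_vector) vbundle \<Rightarrow> bool" where
  "vector_bundle M E \<longleftrightarrow>
     (\<forall>x. subspace (fibre E x)) \<and>
     (\<Union>(U, \<tau>)\<in>trivs E. U) = UNIV \<and>
     (\<forall>(U, \<tau>)\<in>trivs E. open U \<and>
        (\<forall>x\<in>U. bij_betw (\<tau> x) (fibre E x) (topspace (Euclidean_space (brank E))) \<and>
          (\<forall>u\<in>fibre E x. \<forall>v\<in>fibre E x. \<forall>a b.
             \<tau> x (a *\<^sub>R u + b *\<^sub>R v) = (\<lambda>i. a * \<tau> x u i + b * \<tau> x v i)))) \<and>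
     (\<forall>(U, \<tau>)\<in>trivs E. \<forall>(V, \<sigma>)\<in>trivs E. \<forall>i<brank E. \<forall>j<brank E.
        smooth_fun_on M (U \<inter> V) (\<lambda>x. \<sigma> x (frame E \<tau> j x) i))"

definition sections :: "'m manifold \<Rightarrow> ('m, 'e) vbundle \<Rightarrow> ('m \<Rightarrow> 'e) set" where
  "sections M E =
     {X. (\<forall>x. X x \<in> fibre E x) \<and>
         (\<forall>(U, \<tau>)\<in>trivs E. \<forall>i<brank E. smooth_fun_on M U (\<lambda>x. \<tau> x (X x) i))}"

text \<open>
  A (1,1)-tensor is a smooth vector bundle endomorphism over the identity; smoothness is that of
  the matrix entries in local trivialisations.
\<close>

definition tensor11 ::
  "'m manifold \<Rightarrow> ('m, 'e::real_vector) vbundle \<Rightarrow> ('m \<Rightarrow> 'e \<Rightarrow> 'e) \<Rightarrow> bool" where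
  "tensor11 M E J \<longleftrightarrow>
     (\<forall>x. \<forall>u\<in>fibre E x. J x u \<in> fibre E x) \<and>
     (\<forall>x. \<forall>u\<in>fibre E x. \<forall>v\<in>fibre E x. \<forall>a b.
        J x (a *\<^sub>R u + b *\<^sub>R v) = a *\<^sub>R J x u + b *\<^sub>R J x v) \<and>
     (\<forall>(U, \<tau>)\<in>trivs E. \<forall>i<brank E. \<forall>j<brank E.
        smooth_fun_on M U (\<lambda>x. \<tau> x (J x (frame E \<tau> j x)) i))"

definition bundle_metric ::
  "'m manifold \<Rightarrow> ('m, 'e::real_vector) vbundle \<Rightarrow> ('m \<Rightarrow> 'e \<Rightarrow> 'e \<Rightarrow> real) \<Rightarrow> bool" where
  "bundle_metric M E g \<longleftrightarrow>
     (\<forall>x. \<forall>u\<in>fibre E x. \<forall>v\<in>fibre E x. g x u v = g x v u) \<and>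
     (\<forall>x. \<forall>u\<in>fibre E x. \<forall>v\<in>fibre E x. \<forall>w\<in>fibre E x. \<forall>a b.
        g x (a *\<^sub>R u + b *\<^sub>R v) w = a * g x u w + b * g x v w) \<and>
     (\<forall>x. \<forall>u\<in>fibre E x. (\<forall>v\<in>fibre E x. g x u v = 0) \<longrightarrow> u = 0) \<and>
     (\<forall>(U, \<tau>)\<in>trivs E. \<forall>i<brank E. \<forall>j<brank E.
        smooth_fun_on M U (\<lambda>x. g x (frame E \<tau> i x) (frame E \<tau> j x)))"

text \<open>
  A smooth bundle map from E to the tangent bundle. The last clause is smoothness in local
  coordinates: the image of the j-th frame vector is a combination of the coordinate vector
  fields of a chart with smooth coefficients.
\<close>

definition anchor_map ::
  "'m manifold \<Rightarrow> ('m, 'e::real_vector) vbundle \<Rightarrow> ('m \<Rightarrow> 'e \<Rightarrow> ('m \<Rightarrow> real) \<Rightarrow> real) \<Rightarrow> bool" where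
  "anchor_map M E \<rho> \<longleftrightarrow>
     (\<forall>x. \<forall>u\<in>fibre E x. \<rho> x u \<in> tangent_space M x) \<and>
     (\<forall>x. \<forall>u\<in>fibre E x. \<forall>v\<in>fibre E x. \<forall>a b.
        \<rho> x (a *\<^sub>R u + b *\<^sub>R v) = (\<lambda>f. a * \<rho> x u f + b * \<rho> x v f)) \<and>
     (\<forall>(U, \<tau>)\<in>trivs E. \<forall>(V, \<phi>)\<in>atlas M. \<forall>j<brank E.
        \<exists>c. (\<forall>i<mdim M. smooth_fun_on M (U \<inter> V) (c i)) \<and>
            (\<forall>x\<in>U \<inter> V. \<forall>f\<in>smooth_funs M.
               \<rho> x (frame E \<tau> j x) f =
               (\<Sum>i<mdim M. c i x * partial_deriv i (\<lambda>y. f (inv_into V \<phi> y)) (\<phi> x))))"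


section \<open>Pre-Courant structures\<close>

type_synonym ('m, 'e) pc_struct =
  "('m \<Rightarrow> 'e \<Rightarrow> ('m \<Rightarrow> real) \<Rightarrow> real) \<times> (('m \<Rightarrow> 'e) \<Rightarrow> ('m \<Rightarrow> 'e) \<Rightarrow> 'm \<Rightarrow> 'e)"

abbreviation anchor :: "('m, 'e) pc_struct \<Rightarrow> 'm \<Rightarrow> 'e \<Rightarrow> ('m \<Rightarrow> real) \<Rightarrow> real" where
  "anchor \<Theta> \<equiv> fst \<Theta>"

abbreviation bracket :: "('m, 'e) pc_struct \<Rightarrow> ('m \<Rightarrow> 'e) \<Rightarrow> ('m \<Rightarrow> 'e) \<Rightarrow> 'm \<Rightarrow> 'e" where
  "bracket \<Theta> \<equiv> snd \<Theta>"

definition pre_courant_structure ::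
  "'m manifold \<Rightarrow> ('m, 'e::real_vector) vbundle \<Rightarrow> ('m \<Rightarrow> 'e \<Rightarrow> 'e \<Rightarrow> real) \<Rightarrow>
   ('m, 'e) pc_struct \<Rightarrow> bool" where
  "pre_courant_structure M E g \<Theta> \<longleftrightarrow>
     anchor_map M E (anchor \<Theta>) \<and>
     (\<forall>X\<in>sections M E. \<forall>Y\<in>sections M E. bracket \<Theta> X Y \<in> sections M E) \<and>
     (\<forall>X\<in>sections M E. \<forall>Y\<in>sections M E. \<forall>Z\<in>sections M E. \<forall>a b.
        bracket \<Theta> (\<lambda>x. a *\<^sub>R X x + b *\<^sub>R Y x) Z =
          (\<lambda>x. a *\<^sub>R bracket \<Theta> X Z x + b *\<^sub>R bracket \<Theta> Y Z x) \<and>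
        bracket \<Theta> Z (\<lambda>x. a *\<^sub>R X x + b *\<^sub>R Y x) =
          (\<lambda>x. a *\<^sub>R bracket \<Theta> Z X x + b *\<^sub>R bracket \<Theta> Z Y x)) \<and>
     (\<forall>X\<in>sections M E. \<forall>Y\<in>sections M E. \<forall>Z\<in>sections M E. \<forall>x.
        anchor \<Theta> x (X x) (\<lambda>y. g y (Y y) (Z y)) =
          g x (bracket \<Theta> X Y x) (Z x) + g x (Y x) (bracket \<Theta> X Z x)) \<and>
     (\<forall>X\<in>sections M E. \<forall>Y\<in>sections M E. \<forall>Z\<in>sections M E. \<forall>x.
        anchor \<Theta> x (X x) (\<lambda>y. g y (Y y) (Z y)) =
          g x (X x) (bracket \<Theta> Y Z x + bracket \<Theta> Z Y x))"

definition pre_courant_algebroid ::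
  "'m::{t2_space,second_countable_topology} manifold \<Rightarrow> ('m, 'e::real_vector) vbundle \<Rightarrow>
   ('m \<Rightarrow> 'e \<Rightarrow> 'e \<Rightarrow> real) \<Rightarrow> ('m, 'e) pc_struct \<Rightarrow> bool" where
  "pre_courant_algebroid M E g \<Theta> \<longleftrightarrow>
     smooth_manifold M \<and> vector_bundle M E \<and> bundle_metric M E g \<and>
     pre_courant_structure M E g \<Theta>"

definition pc_add ::
  "('m, 'e::real_vector) pc_struct \<Rightarrow> ('m, 'e) pc_struct \<Rightarrow> ('m, 'e) pc_struct" where
  "pc_add \<Theta> \<Theta>' =
     (\<lambda>x u f. anchor \<Theta> x u f + anchor \<Theta>' x u f,
      \<lambda>X Y x. bracket \<Theta> X Y x + bracket \<Theta>' X Y x)"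

text \<open>
  Anchors matter only on the fibres and brackets only on smooth sections, so vanishing of a pair
  is required there only.
\<close>

definition pc_is_zero ::
  "'m manifold \<Rightarrow> ('m, 'e::real_vector) vbundle \<Rightarrow> ('m, 'e) pc_struct \<Rightarrow> bool" where
  "pc_is_zero M E \<Theta> \<longleftrightarrow>
     (\<forall>x. \<forall>u\<in>fibre E x. anchor \<Theta> x u = (\<lambda>f. 0)) \<and>
     (\<forall>X\<in>sections M E. \<forall>Y\<in>sections M E. bracket \<Theta> X Y = (\<lambda>x. 0))"


section \<open>Deformation, torsion, concomitant and compatibility\<close>

definition app :: "('m \<Rightarrow> 'e \<Rightarrow> 'e) \<Rightarrow> ('m \<Rightarrow> 'e) \<Rightarrow> 'm \<Rightarrow> 'e" where
  "app J X = (\<lambda>x. J x (X x))"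

definition skew_symmetric ::
  "('m, 'e) vbundle \<Rightarrow> ('m \<Rightarrow> 'e \<Rightarrow> 'e \<Rightarrow> real) \<Rightarrow> ('m \<Rightarrow> 'e \<Rightarrow> 'e) \<Rightarrow> bool" where
  "skew_symmetric E g J \<longleftrightarrow>
     (\<forall>x. \<forall>u\<in>fibre E x. \<forall>v\<in>fibre E x. g x (J x u) v + g x u (J x v) = 0)"

definition deform ::
  "('m \<Rightarrow> 'e::real_vector \<Rightarrow> 'e) \<Rightarrow> ('m, 'e) pc_struct \<Rightarrow> ('m, 'e) pc_struct" where
  "deform J \<Theta> =
     (\<lambda>x u. anchor \<Theta> x (J x u),
      \<lambda>X Y x. bracket \<Theta> (app J X) Y x + bracket \<Theta> X (app J Y) x - J x (bracket \<Theta> X Y x))"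

definition torsion ::
  "('m, 'e::real_vector) pc_struct \<Rightarrow> ('m \<Rightarrow> 'e \<Rightarrow> 'e) \<Rightarrow> ('m \<Rightarrow> 'e) \<Rightarrow> ('m \<Rightarrow> 'e) \<Rightarrow> 'm \<Rightarrow> 'e" where
  "torsion \<Theta> I X Y =
     (\<lambda>x. bracket \<Theta> (app I X) (app I Y) x - I x (bracket (deform I \<Theta>) X Y x))"

text \<open>With two indices, the structure is deformed first by the left one.\<close>

definition concomitant ::
  "('m, 'e::real_vector) pc_struct \<Rightarrow> ('m \<Rightarrow> 'e \<Rightarrow> 'e) \<Rightarrow> ('m \<Rightarrow> 'e \<Rightarrow> 'e) \<Rightarrow> ('m, 'e) pc_struct" where
  "concomitant \<Theta> I J = pc_add (deform J (deform I \<Theta>)) (deform I (deform J \<Theta>))"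

definition compatible_pair ::
  "'m manifold \<Rightarrow> ('m, 'e::real_vector) vbundle \<Rightarrow> ('m \<Rightarrow> 'e \<Rightarrow> 'e \<Rightarrow> real) \<Rightarrow>
   ('m, 'e) pc_struct \<Rightarrow> ('m \<Rightarrow> 'e \<Rightarrow> 'e) \<Rightarrow> ('m \<Rightarrow> 'e \<Rightarrow> 'e) \<Rightarrow> bool" where
  "compatible_pair M E g \<Theta> I J \<longleftrightarrow>
     tensor11 M E I \<and> tensor11 M E J \<and>
     skew_symmetric E g I \<and> skew_symmetric E g J \<and>
     (\<forall>x. \<forall>u\<in>fibre E x. I x (J x u) = - J x (I x u)) \<and>
     pc_is_zero M E (concomitant \<Theta> I J)"

end

theory Submission imports Defs begin

text \<open>
  For anticommuting I and J, the bracket of the concomitant is twice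
  D(X, Y) = [IX, JY] + [JX, IY] - I([JX, Y] + [X, JY]) - J([IX, Y] + [X, IY]),
  and its anchor vanishes. Bilinearity of the bracket alone gives, with T the torsion of I and
  S(X, Y) = T(JX, Y) + T(X, JY):
  replacing J by IJ turns D into S + I D, and deforming the bracket by I turns D(X, Y) into
  D(IX, Y) + D(X, IY) + I D(X, Y) + 2 S(X, Y) and T(X, Y) into T(IX, Y) + T(X, IY) - I T(X, Y).
  Since IJ = -JI, the hypotheses on D and T therefore persist under both operations.
\<close>

section \<open>Smoothness of sums and products\<close>

lemma Ck_on_continuous:
  "Ck_on k n V f \<Longrightarrow> continuous_map (subtopology (Euclidean_space n) V) euclideanreal f"
  by (cases k) auto

lemma Ck_on_SucD: "Ck_on (Suc k) n V f \<Longrightarrow> Ck_on k n V f"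
proof (induction k arbitrary: f)
  case (Suc k)
  then show ?case by (metis Ck_on.simps(2))
qed simp

lemma Ck_on_SucE:
  assumes "Ck_on (Suc k) n V f" "i < n"
  obtains D where "\<And>x. x \<in> V \<Longrightarrow> ((\<lambda>t. f (x(i := t))) has_real_derivative D x) (at (x i))"
    and "Ck_on k n V D"
proof -
  have "\<exists>D. (\<forall>x\<in>V. ((\<lambda>t. f (x(i := t))) has_real_derivative D x) (at (x i))) \<and> Ck_on k n V D"
    using assms by simp
  then show ?thesis using that by blast
qed

lemma Ck_on_const: "Ck_on k n V (\<lambda>x. c)"
proof (induction k arbitrary: c)
  case (Suc k)
  \<comment> \<open>Every partial derivative is the constant 0, so the induction hypothesis is taken
    at 0 and has to cover all constants.\<close>
  have "\<forall>i<n. \<exists>D. (\<forall>x\<in>V. ((\<lambda>t. c) has_real_derivative D x) (at (x i))) \<and> Ck_on k n V D"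
    using Suc.IH[of 0] by (intro allI impI exI[of _ "\<lambda>x. 0"]) auto
  then show ?case by simp
qed simp

lemma Ck_on_add: "Ck_on k n V f \<Longrightarrow> Ck_on k n V h \<Longrightarrow> Ck_on k n V (\<lambda>x. f x + h x)"
proof (induction k arbitrary: f h)
  case 0
  then show ?case by (simp add: continuous_map_add)
next
  case (Suc k)
  have "\<exists>D. (\<forall>x\<in>V. ((\<lambda>t. f (x(i := t)) + h (x(i := t))) has_real_derivative D x) (at (x i))) \<and>
      Ck_on k n V D" if i: "i < n" for i
  proof -
    obtain D where D: "\<And>x. x \<in> V \<Longrightarrow> ((\<lambda>t. f (x(i := t))) has_real_derivative D x) (at (x i))"
      "Ck_on k n V D"
      by (rule Ck_on_SucE[OF Suc.prems(1) i]) (rule that)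
    obtain D' where D': "\<And>x. x \<in> V \<Longrightarrow> ((\<lambda>t. h (x(i := t))) has_real_derivative D' x) (at (x i))"
      "Ck_on k n V D'"
      by (rule Ck_on_SucE[OF Suc.prems(2) i]) (rule that)
    have "((\<lambda>t. f (x(i := t)) + h (x(i := t))) has_real_derivative D x + D' x) (at (x i))"
      if "x \<in> V" for x
      by (rule DERIV_add[OF D(1)[OF that] D'(1)[OF that]])
    then show ?thesis
      using Suc.IH[OF D(2) D'(2)] by (intro exI[of _ "\<lambda>x. D x + D' x"]) simp
  qed
  then show ?case using Suc.prems by (simp add: continuous_map_add)
qed

lemma Ck_on_mult: "Ck_on k n V f \<Longrightarrow> Ck_on k n V h \<Longrightarrow> Ck_on k n V (\<lambda>x. f x * h x)"
proof (induction k arbitrary: f h)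
  case 0
  then show ?case by (simp add: continuous_map_real_mult)
next
  case (Suc k)
  have "\<exists>D. (\<forall>x\<in>V. ((\<lambda>t. f (x(i := t)) * h (x(i := t))) has_real_derivative D x) (at (x i))) \<and>
      Ck_on k n V D" if i: "i < n" for i
  proof -
    obtain D where D: "\<And>x. x \<in> V \<Longrightarrow> ((\<lambda>t. f (x(i := t))) has_real_derivative D x) (at (x i))"
      "Ck_on k n V D"
      by (rule Ck_on_SucE[OF Suc.prems(1) i]) (rule that)
    obtain D' where D': "\<And>x. x \<in> V \<Longrightarrow> ((\<lambda>t. h (x(i := t))) has_real_derivative D' x) (at (x i))"
      "Ck_on k n V D'"
      by (rule Ck_on_SucE[OF Suc.prems(2) i]) (rule that)
    have "((\<lambda>t. f (x(i := t)) * h (x(i := t))) has_real_derivative D x * h x + D' x * f x) (at (x i))"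
      if "x \<in> V" for x
      using DERIV_mult[OF D(1)[OF that] D'(1)[OF that]] by simp
    \<comment> \<open>The product rule pairs each derivative with an undifferentiated factor, which
      \<open>Ck_on_SucD\<close> first lowers to order \<open>k\<close>.\<close>
    moreover have "Ck_on k n V (\<lambda>x. D x * h x + D' x * f x)"
      by (intro Ck_on_add Suc.IH Ck_on_SucD[OF Suc.prems(1)] Ck_on_SucD[OF Suc.prems(2)] D(2) D'(2))
    ultimately show ?thesis by (intro exI[of _ "\<lambda>x. D x * h x + D' x * f x"]) simp
  qed
  then show ?case using Suc.prems by (simp add: continuous_map_real_mult)
qed

section \<open>Locality of smoothness on open sets\<close>

lemma has_real_derivative_line_cong:
  assumes V: "openin (Euclidean_space n) V" and "x \<in> V" "i < n"
    and eq: "\<And>y. y \<in> V \<Longrightarrow> f y = h y"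
    and f: "((\<lambda>t. f (x(i := t))) has_real_derivative d) (at (x i))"
  shows "((\<lambda>t. h (x(i := t))) has_real_derivative d) (at (x i))"
proof -
  have "x \<in> topspace (Euclidean_space n)"
    using V \<open>x \<in> V\<close> openin_subset by blast
  \<comment> \<open>Derivatives in \<open>Ck_on\<close> run along the coordinate line through
    \<open>x\<close>, which may leave \<open>V\<close>. As \<open>i < n\<close>, the line stays in
    Euclidean space, so by continuity the parameters landing in \<open>V\<close> form an open set
    around \<open>x i\<close>, on which both functions agree.\<close>
  then have line: "continuous_map euclideanreal (Euclidean_space n) (\<lambda>t. x(i := t))"
    using \<open>i < n\<close> unfolding Euclidean_space_def continuous_map_in_subtopology
    by (auto simp: continuous_map_componentwise_UNIV topspace_Euclidean_space)
  have "open {t. x(i := t) \<in> V}"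
    using openin_continuous_map_preimage[OF line V] by simp
  moreover have "x i \<in> {t. x(i := t) \<in> V}" using \<open>x \<in> V\<close> by simp
  ultimately show ?thesis
    using f eq by (rule_tac has_field_derivative_transform_within_open[OF f]) auto
qed

text \<open>A partial derivative of \<open>f\<close> serves unchanged for \<open>h\<close>, so a
  case distinction on \<open>k\<close> replaces an induction.\<close>

lemma Ck_on_cong:
  assumes V: "openin (Euclidean_space n) V" and eq: "\<And>y. y \<in> V \<Longrightarrow> f y = h y"
    and f: "Ck_on k n V f"
  shows "Ck_on k n V h"
proof -
  have "continuous_map (subtopology (Euclidean_space n) V) euclideanreal h"
    using Ck_on_continuous[OF f] by (rule continuous_map_eq) (use eq in auto)
  moreover have "\<exists>D. (\<forall>x\<in>V. ((\<lambda>t. h (x(i := t))) has_real_derivative D x) (at (x i))) \<and> Ck_on l n V D"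
    if k: "k = Suc l" and i: "i < n" for l i
  proof -
    obtain D where D: "\<And>x. x \<in> V \<Longrightarrow> ((\<lambda>t. f (x(i := t))) has_real_derivative D x) (at (x i))"
      "Ck_on l n V D"
      by (rule Ck_on_SucE[OF f[unfolded k] i]) (rule that)
    have "((\<lambda>t. h (x(i := t))) has_real_derivative D x) (at (x i))" if "x \<in> V" for x
      by (rule has_real_derivative_line_cong[OF V that i eq D(1)[OF that]])
    then show ?thesis using D(2) by (intro exI[of _ D]) simp
  qed
  ultimately show ?thesis by (cases k) auto
qed

lemma smooth_fun_on_const: "smooth_fun_on M W (\<lambda>x. c)"
  by (simp add: smooth_fun_on_def smooth_on_Rn_def Ck_on_const)

lemma smooth_fun_on_add:
  "smooth_fun_on M W f \<Longrightarrow> smooth_fun_on M W h \<Longrightarrow> smooth_fun_on M W (\<lambda>x. f x + h x)"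
  unfolding smooth_fun_on_def smooth_on_Rn_def by (auto intro!: Ck_on_add)

lemma smooth_fun_on_mult:
  "smooth_fun_on M W f \<Longrightarrow> smooth_fun_on M W h \<Longrightarrow> smooth_fun_on M W (\<lambda>x. f x * h x)"
  unfolding smooth_fun_on_def smooth_on_Rn_def by (auto intro!: Ck_on_mult)

lemma smooth_fun_on_sum:
  "(\<And>j. j \<in> A \<Longrightarrow> smooth_fun_on M W (f j)) \<Longrightarrow> smooth_fun_on M W (\<lambda>x. \<Sum>j\<in>A. f j x)"
  by (induction A rule: infinite_finite_induct) (auto intro: smooth_fun_on_const smooth_fun_on_add)

lemma smooth_fun_on_cong:
  assumes M: "smooth_manifold M" and W: "open W" and eq: "\<And>x. x \<in> W \<Longrightarrow> f x = h x"
    and f: "smooth_fun_on M W f"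
  shows "smooth_fun_on M W h"
  unfolding smooth_fun_on_def smooth_on_Rn_def
proof (clarify)
  fix U \<phi> k
  assume A: "(U, \<phi>) \<in> atlas M"
  have op: "openin (Euclidean_space (mdim M)) (\<phi> ` U)"
    and hom: "homeomorphic_map (top_of_set U) (subtopology (Euclidean_space (mdim M)) (\<phi> ` U)) \<phi>"
    using M A unfolding smooth_manifold_def by blast+
  \<comment> \<open>A chart is an open map onto its image, and that image is open in Euclidean
    space; this gives the openness that \<open>Ck_on_cong\<close> requires.\<close>
  have "openin (subtopology (Euclidean_space (mdim M)) (\<phi> ` U)) (\<phi> ` (U \<inter> W))"
    using homeomorphic_imp_open_map[OF hom] W unfolding open_map_def by blast
  then have V: "openin (Euclidean_space (mdim M)) (\<phi> ` (U \<inter> W))"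
    using op openin_trans_full by blast
  have inj: "inj_on \<phi> U"
    using homeomorphic_imp_injective_map[OF hom] by simp
  have f': "Ck_on k (mdim M) (\<phi> ` (U \<inter> W)) (\<lambda>y. f (inv_into U \<phi> y))"
    using f A unfolding smooth_fun_on_def smooth_on_Rn_def by blast
  show "Ck_on k (mdim M) (\<phi> ` (U \<inter> W)) (\<lambda>y. h (inv_into U \<phi> y))"
    by (rule Ck_on_cong[OF V _ f']) (use inj eq in auto)
qed

section \<open>Tensors acting on sections\<close>

lemma subspace_fibre: "vector_bundle M E \<Longrightarrow> subspace (fibre E x)"
  by (simp add: vector_bundle_def)

lemma trivialisationD:
  assumes E: "vector_bundle M E" and t: "(U, \<tau>) \<in> trivs E"
  shows "open U"
    and "x \<in> U \<Longrightarrow> bij_betw (\<tau> x) (fibre E x) (topspace (Euclidean_space (brank E)))"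
    and "x \<in> U \<Longrightarrow> u \<in> fibre E x \<Longrightarrow> v \<in> fibre E x \<Longrightarrow>
      \<tau> x (a *\<^sub>R u + b *\<^sub>R v) = (\<lambda>i. a * \<tau> x u i + b * \<tau> x v i)"
proof -
  have "\<forall>(U, \<tau>)\<in>trivs E. open U \<and>
        (\<forall>x\<in>U. bij_betw (\<tau> x) (fibre E x) (topspace (Euclidean_space (brank E))) \<and>
          (\<forall>u\<in>fibre E x. \<forall>v\<in>fibre E x. \<forall>a b.
             \<tau> x (a *\<^sub>R u + b *\<^sub>R v) = (\<lambda>i. a * \<tau> x u i + b * \<tau> x v i)))"
    using E unfolding vector_bundle_def by (elim conjE)
  from bspec[OF this t] show "open U"
    and "x \<in> U \<Longrightarrow> bij_betw (\<tau> x) (fibre E x) (topspace (Euclidean_space (brank E)))"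
    and "x \<in> U \<Longrightarrow> u \<in> fibre E x \<Longrightarrow> v \<in> fibre E x \<Longrightarrow>
      \<tau> x (a *\<^sub>R u + b *\<^sub>R v) = (\<lambda>i. a * \<tau> x u i + b * \<tau> x v i)"
    by simp_all
qed

text \<open>Both sides lie in the fibre and have the same coordinates under the linear bijection
  \<open>\<tau> x\<close>.\<close>

lemma frame_expansion:
  assumes E: "vector_bundle M E" and t: "(U, \<tau>) \<in> trivs E" and x: "x \<in> U" and u: "u \<in> fibre E x"
  shows "u = (\<Sum>j<brank E. \<tau> x u j *\<^sub>R frame E \<tau> j x)"
    and "j < brank E \<Longrightarrow> frame E \<tau> j x \<in> fibre E x"
proof -
  note bij = trivialisationD(2)[OF E t x] and lin = trivialisationD(3)[OF E t x]
    and sub = subspace_fibre[OF E, of x]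
  \<comment> \<open>For \<open>j\<close> below the rank the unit vector lies in the model space, so
    \<open>inv_into\<close> in \<open>frame\<close> picks a genuine preimage.\<close>
  have e: "(\<lambda>i. if i = j then 1 else 0) \<in> \<tau> x ` fibre E x" if "j < brank E" for j
    using that bij unfolding bij_betw_def topspace_Euclidean_space by auto
  have fr: "frame E \<tau> j x \<in> fibre E x" "\<tau> x (frame E \<tau> j x) = (\<lambda>i. if i = j then 1 else 0)"
    if "j < brank E" for j
    using inv_into_into[OF e[OF that]] f_inv_into_f[OF e[OF that]] unfolding frame_def by auto
  show "j < brank E \<Longrightarrow> frame E \<tau> j x \<in> fibre E x" by (rule fr)
  have zero: "\<tau> x 0 = (\<lambda>i. 0)"
    using lin[of 0 0 0 0] subspace_0[OF sub] by simp
  have part: "(\<Sum>j<m. c j *\<^sub>R frame E \<tau> j x) \<in> fibre E x \<and>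
      \<tau> x (\<Sum>j<m. c j *\<^sub>R frame E \<tau> j x) = (\<lambda>i. if i < m then c i else 0)"
    if "m \<le> brank E" for c :: "nat \<Rightarrow> real" and m
    using that
  proof (induction m)
    case 0
    then show ?case using zero subspace_0[OF sub] by simp
  next
    case (Suc m)
    then have IH: "(\<Sum>j<m. c j *\<^sub>R frame E \<tau> j x) \<in> fibre E x"
      "\<tau> x (\<Sum>j<m. c j *\<^sub>R frame E \<tau> j x) = (\<lambda>i. if i < m then c i else 0)" and m: "m < brank E"
      by auto
    show ?case
      using lin[OF IH(1) fr(1)[OF m], of 1 "c m"] IH fr[OF m]
      by (auto simp: less_Suc_eq intro!: subspace_add[OF sub] subspace_scale[OF sub] ext)
  qed
  \<comment> \<open>Points of the model space vanish from the rank on, so the cut-off at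
    \<open>brank E\<close> in \<open>part\<close> loses nothing.\<close>
  have "\<tau> x u i = 0" if "\<not> i < brank E" for i
    using bij_betw_apply[OF bij u] that by (auto simp: topspace_Euclidean_space)
  then have "\<tau> x u = \<tau> x (\<Sum>j<brank E. \<tau> x u j *\<^sub>R frame E \<tau> j x)"
    using part[of "brank E" "\<tau> x u"] by auto
  then show "u = (\<Sum>j<brank E. \<tau> x u j *\<^sub>R frame E \<tau> j x)"
    using bij u part[of "brank E" "\<tau> x u"] unfolding bij_betw_def by (meson inj_onD order_refl)
qed

lemma app_comp: "app (\<lambda>x. I x \<circ> J x) X = app I (app J X)"
  by (simp add: app_def)

lemma tensor11_mem: "tensor11 M E J \<Longrightarrow> u \<in> fibre E x \<Longrightarrow> J x u \<in> fibre E x"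
  unfolding tensor11_def by blast

lemma tensor11_lincomb:
  "tensor11 M E J \<Longrightarrow> u \<in> fibre E x \<Longrightarrow> v \<in> fibre E x \<Longrightarrow>
    J x (a *\<^sub>R u + b *\<^sub>R v) = a *\<^sub>R J x u + b *\<^sub>R J x v"
  unfolding tensor11_def by blast

text \<open>The matrix form of \<open>J\<close>: expand \<open>u\<close> in the local frame and use
  linearity of \<open>J x\<close> and \<open>\<tau> x\<close>.\<close>

lemma tensor11_coord:
  assumes E: "vector_bundle M E" and J: "tensor11 M E J"
    and t: "(U, \<tau>) \<in> trivs E" and x: "x \<in> U" and u: "u \<in> fibre E x"
  shows "\<tau> x (J x u) i = (\<Sum>j<brank E. \<tau> x u j * \<tau> x (J x (frame E \<tau> j x)) i)"
proof -
  note lin = trivialisationD(3)[OF E t x] and sub = subspace_fibre[OF E, of x]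
  have "(\<Sum>j<m. c j *\<^sub>R frame E \<tau> j x) \<in> fibre E x \<and>
      \<tau> x (J x (\<Sum>j<m. c j *\<^sub>R frame E \<tau> j x)) i = (\<Sum>j<m. c j * \<tau> x (J x (frame E \<tau> j x)) i)"
    if "m \<le> brank E" for c :: "nat \<Rightarrow> real" and m
    using that
  proof (induction m)
    case 0
    have "J x 0 = 0" "\<tau> x 0 i = 0"
      using tensor11_lincomb[OF J, of 0 x 0 0 0] lin[of 0 0 0 0] subspace_0[OF sub] by simp_all
    then show ?case using subspace_0[OF sub] by simp
  next
    case (Suc m)
    let ?s = "\<Sum>j<m. c j *\<^sub>R frame E \<tau> j x" and ?f = "frame E \<tau> m x"
    have IH: "?s \<in> fibre E x" "\<tau> x (J x ?s) i = (\<Sum>j<m. c j * \<tau> x (J x (frame E \<tau> j x)) i)"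
      using Suc by auto
    have f: "?f \<in> fibre E x"
      using frame_expansion(2)[OF E t x u] Suc.prems by simp
    have "\<tau> x (J x (?s + c m *\<^sub>R ?f)) i = \<tau> x (J x ?s) i + c m * \<tau> x (J x ?f) i"
      using tensor11_lincomb[OF J IH(1) f, of 1 "c m"]
        lin[OF tensor11_mem[OF J IH(1)] tensor11_mem[OF J f], of 1 "c m"] by simp
    then show ?case
      using IH f by (auto intro!: subspace_add[OF sub] subspace_scale[OF sub])
  qed
  from this[of "brank E" "\<tau> x u"] show ?thesis
    using frame_expansion(1)[OF E t x u] by simp
qed

text \<open>Coordinates of the image are sums of products of smooth functions. The coordinate
  formula holds over \<open>U\<close> only, hence the appeal to \<open>smooth_fun_on_cong\<close>.
  Bracket rules are available on smooth sections only, so every bracket with an argument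
  \<open>app I X\<close> rests on this.\<close>

lemma app_in_sections:
  assumes M: "smooth_manifold M" and E: "vector_bundle M E" and J: "tensor11 M E J"
    and X: "X \<in> sections M E"
  shows "app J X \<in> sections M E"
proof -
  have fib: "X x \<in> fibre E x" for x using X unfolding sections_def by blast
  have "smooth_fun_on M U (\<lambda>x. \<tau> x (J x (X x)) i)" if t: "(U, \<tau>) \<in> trivs E" and i: "i < brank E" for U \<tau> i
  proof -
    have sm: "smooth_fun_on M U (\<lambda>x. \<Sum>j<brank E. \<tau> x (X x) j * \<tau> x (J x (frame E \<tau> j x)) i)"
      using J X t i unfolding tensor11_def sections_def
      by (intro smooth_fun_on_sum smooth_fun_on_mult) auto
    show ?thesis
      by (rule smooth_fun_on_cong[OF M trivialisationD(1)[OF E t] _ sm]) (rule tensor11_coord[OF E J t _ fib, symmetric])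
  qed
  then show ?thesis
    using fib tensor11_mem[OF J] unfolding sections_def app_def by blast
qed

lemma tensor11_comp:
  assumes M: "smooth_manifold M" and E: "vector_bundle M E"
    and I: "tensor11 M E I" and J: "tensor11 M E J"
  shows "tensor11 M E (\<lambda>x. I x \<circ> J x)"
proof -
  have "smooth_fun_on M U (\<lambda>x. \<tau> x (I x (J x (frame E \<tau> j x))) i)"
    if t: "(U, \<tau>) \<in> trivs E" and i: "i < brank E" and j: "j < brank E" for U \<tau> i j
  proof -
    \<comment> \<open>The vector 0 serves as the fibre element in
      \<open>frame_expansion\<close>.\<close>
    have mem: "J x (frame E \<tau> j x) \<in> fibre E x" if "x \<in> U" for x
      using tensor11_mem[OF J] frame_expansion(2)[OF E t that subspace_0[OF subspace_fibre[OF E]] j] by blast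
    \<comment> \<open>These are the entries of the product of the matrices of \<open>I\<close> and
      \<open>J\<close>.\<close>
    have sm: "smooth_fun_on M U (\<lambda>x. \<Sum>l<brank E.
        \<tau> x (J x (frame E \<tau> j x)) l * \<tau> x (I x (frame E \<tau> l x)) i)"
      using I J t i j unfolding tensor11_def
      by (intro smooth_fun_on_sum smooth_fun_on_mult) auto
    show ?thesis
      by (rule smooth_fun_on_cong[OF M trivialisationD(1)[OF E t] _ sm])
        (rule tensor11_coord[OF E I t _ mem, symmetric])
  qed
  then show ?thesis
    using I J unfolding tensor11_def comp_apply by (intro conjI ballI allI) auto
qed

section \<open>The half concomitant\<close>

text \<open>The D of the opening comment. For anticommuting \<open>I\<close> and \<open>J\<close> it
  is the polarised torsion: the torsion of I + J minus those of I and of J.\<close>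

definition half_concomitant ::
  "('m, 'e::real_vector) pc_struct \<Rightarrow> ('m \<Rightarrow> 'e \<Rightarrow> 'e) \<Rightarrow> ('m \<Rightarrow> 'e \<Rightarrow> 'e) \<Rightarrow>
   ('m \<Rightarrow> 'e) \<Rightarrow> ('m \<Rightarrow> 'e) \<Rightarrow> 'm \<Rightarrow> 'e" where
  "half_concomitant \<Theta> I J X Y x =
     bracket \<Theta> (app I X) (app J Y) x + bracket \<Theta> (app J X) (app I Y) x
     - I x (bracket \<Theta> (app J X) Y x + bracket \<Theta> X (app J Y) x)
     - J x (bracket \<Theta> (app I X) Y x + bracket \<Theta> X (app I Y) x)"

text \<open>
  Of the pre-Courant structure and of the metric only compatibility with the fibres and with sign
  changes is kept; this passes to deformed structures without closure of sections under sums.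
\<close>

locale anticommuting_pair =
  fixes M :: "'m::{t2_space,second_countable_topology} manifold"
    and E :: "('m, 'e::real_vector) vbundle"
    and g :: "'m \<Rightarrow> 'e \<Rightarrow> 'e \<Rightarrow> real"
    and \<Theta> :: "('m, 'e) pc_struct"
    and I J :: "'m \<Rightarrow> 'e \<Rightarrow> 'e"
  assumes M: "smooth_manifold M" and E: "vector_bundle M E"
    and I: "tensor11 M E I" and J: "tensor11 M E J"
    and skew_I: "skew_symmetric E g I" and skew_J: "skew_symmetric E g J"
    and anticommute: "u \<in> fibre E x \<Longrightarrow> J x (I x u) = - I x (J x u)"
    and metric_minus: "u \<in> fibre E x \<Longrightarrow> v \<in> fibre E x \<Longrightarrow> g x (- u) v = - g x u v"
    and anchor_minus: "u \<in> fibre E x \<Longrightarrow> anchor \<Theta> x (- u) = (\<lambda>f. - anchor \<Theta> x u f)"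
    and bracket_mem: "X \<in> sections M E \<Longrightarrow> Y \<in> sections M E \<Longrightarrow> bracket \<Theta> X Y x \<in> fibre E x"
    and bracket_minus:
      "X \<in> sections M E \<Longrightarrow> Y \<in> sections M E \<Longrightarrow>
        bracket \<Theta> (\<lambda>x. - X x) Y = (\<lambda>x. - bracket \<Theta> X Y x) \<and>
        bracket \<Theta> X (\<lambda>x. - Y x) = (\<lambda>x. - bracket \<Theta> X Y x)"
begin

section \<open>Membership and sign rules\<close>

lemma fibre_add: "u \<in> fibre E x \<Longrightarrow> v \<in> fibre E x \<Longrightarrow> u + v \<in> fibre E x"
  and fibre_diff: "u \<in> fibre E x \<Longrightarrow> v \<in> fibre E x \<Longrightarrow> u - v \<in> fibre E x"
  and fibre_minus: "u \<in> fibre E x \<Longrightarrow> - u \<in> fibre E x"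
  using subspace_fibre[OF E] by (auto intro: subspace_add subspace_diff subspace_neg)

lemma tensor_add:
  assumes "tensor11 M E K" "u \<in> fibre E x" "v \<in> fibre E x"
  shows "K x (u + v) = K x u + K x v"
  using tensor11_lincomb[OF assms, of 1 1] by simp

lemma tensor_diff:
  assumes "tensor11 M E K" "u \<in> fibre E x" "v \<in> fibre E x"
  shows "K x (u - v) = K x u - K x v"
  using tensor11_lincomb[OF assms, of 1 "- 1"] by simp

lemma tensor_minus:
  assumes "tensor11 M E K" "u \<in> fibre E x"
  shows "K x (- u) = - K x u"
  using tensor11_lincomb[OF assms assms(2), of "- 1" 0] by simp

lemma app_mem:
  assumes "X \<in> sections M E"
  shows "app I X \<in> sections M E" "app J X \<in> sections M E"
  using app_in_sections[OF M E] I J assms by auto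

lemma section_mem: "X \<in> sections M E \<Longrightarrow> X x \<in> fibre E x"
  unfolding sections_def by blast

lemma app_anticommute: "X \<in> sections M E \<Longrightarrow> app J (app I X) = (\<lambda>x. - app I (app J X) x)"
  unfolding app_def using anticommute section_mem by fast

lemma app_minus:
  assumes "X \<in> sections M E"
  shows "app I (\<lambda>x. - X x) = (\<lambda>x. - app I X x)" "app J (\<lambda>x. - X x) = (\<lambda>x. - app J X x)"
  unfolding app_def using tensor_minus[OF I] tensor_minus[OF J] section_mem[OF assms] by auto

lemmas mems = app_mem bracket_mem tensor11_mem[OF I] tensor11_mem[OF J] fibre_add fibre_diff fibre_minus

text \<open>Rewriting to a normal form: \<open>I\<close> moves outside \<open>J\<close>, signs leave
  brackets and tensors, and tensors distribute over sums of brackets. Bracket arguments remain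
  single sections up to sign, so sign rules suffice inside brackets.\<close>

lemmas expand = mems app_anticommute app_minus anticommute
  conjunct1[OF bracket_minus] conjunct2[OF bracket_minus]
  tensor_add[OF I] tensor_add[OF J] tensor_diff[OF I] tensor_diff[OF J]
  tensor_minus[OF I] tensor_minus[OF J]

section \<open>Expansions of concomitant and torsion\<close>

lemma bracket_concomitant:
  assumes "X \<in> sections M E" "Y \<in> sections M E"
  shows "bracket (concomitant \<Theta> I J) X Y x = 2 *\<^sub>R half_concomitant \<Theta> I J X Y x"
  \<comment> \<open>Terms with \<open>I\<close> and \<open>J\<close> on the same argument, or both
    outside the bracket, cancel between the two orders of deformation; every other term occurs in
    both orders, whence the factor 2.\<close>
  using assms by (simp add: concomitant_def pc_add_def deform_def half_concomitant_def expand
      scaleR_2 algebra_simps)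

text \<open>The anchor part is the anchor at IJu plus the anchor at JIu, which cancel by
  anticommutation; in the bracket part the factor 2 drops out.\<close>

lemma concomitant_zero_iff:
  "pc_is_zero M E (concomitant \<Theta> I J) \<longleftrightarrow>
    (\<forall>X\<in>sections M E. \<forall>Y\<in>sections M E. half_concomitant \<Theta> I J X Y = (\<lambda>x. 0))"
proof -
  have "anchor (concomitant \<Theta> I J) x u = (\<lambda>f. 0)" if "u \<in> fibre E x" for x u
    using that by (simp add: concomitant_def pc_add_def deform_def anticommute anchor_minus mems)
  moreover have "bracket (concomitant \<Theta> I J) X Y = (\<lambda>x. 0) \<longleftrightarrow> half_concomitant \<Theta> I J X Y = (\<lambda>x. 0)"
    if "X \<in> sections M E" "Y \<in> sections M E" for X Y
    by (simp add: fun_eq_iff bracket_concomitant[OF that])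
  ultimately show ?thesis
    unfolding pc_is_zero_def by auto
qed

text \<open>The mixed brackets under a single \<open>I\<close>, and the terms with \<open>I\<close>
  applied twice outside, cancel between the two torsions and the last summand.\<close>

lemma half_concomitant_comp:
  assumes "X \<in> sections M E" "Y \<in> sections M E"
  shows "half_concomitant \<Theta> I (\<lambda>x. I x \<circ> J x) X Y x =
    torsion \<Theta> I (app J X) Y x + torsion \<Theta> I X (app J Y) x + I x (half_concomitant \<Theta> I J X Y x)"
  using assms by (simp add: deform_def half_concomitant_def torsion_def app_comp expand algebra_simps)

text \<open>The factor 2 compensates a sign: [IJX, IY] occurs with + on the left, but D(IX, Y)
  contributes it as [JIX, IY] = -[IJX, IY]; likewise for [IX, IJY].\<close>

lemma half_concomitant_deform:
  assumes "X \<in> sections M E" "Y \<in> sections M E"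
  shows "half_concomitant (deform I \<Theta>) I J X Y x =
    half_concomitant \<Theta> I J (app I X) Y x + half_concomitant \<Theta> I J X (app I Y) x
    + I x (half_concomitant \<Theta> I J X Y x)
    + 2 *\<^sub>R (torsion \<Theta> I (app J X) Y x + torsion \<Theta> I X (app J Y) x)"
  using assms by (simp add: deform_def half_concomitant_def torsion_def expand scaleR_2 algebra_simps)

lemma torsion_deform:
  assumes "X \<in> sections M E" "Y \<in> sections M E"
  shows "torsion (deform I \<Theta>) I X Y x =
    torsion \<Theta> I (app I X) Y x + torsion \<Theta> I X (app I Y) x - I x (torsion \<Theta> I X Y x)"
  using assms by (simp add: deform_def torsion_def expand algebra_simps)

lemma torsion_minus:
  assumes "X \<in> sections M E" "Y \<in> sections M E"
  shows "torsion \<Theta> I (\<lambda>x. - X x) Y x = - torsion \<Theta> I X Y x"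
    and "torsion \<Theta> I X (\<lambda>x. - Y x) x = - torsion \<Theta> I X Y x"
  using assms by (simp_all add: deform_def torsion_def expand algebra_simps)

lemma tensor_zero: "I x 0 = 0"
proof -
  have "0 \<in> fibre E x" by (rule subspace_0[OF subspace_fibre[OF E]])
  then show ?thesis using tensor11_lincomb[OF I, of 0 x 0 0 0] by simp
qed

section \<open>Closure under deformation and composition\<close>

lemma anticommuting_pair_deform: "anticommuting_pair M E g (deform I \<Theta>) I J"
proof (unfold_locales, goal_cases)
  case (9 u x)
  then show ?case by (simp add: deform_def anchor_minus tensor_minus[OF I] mems)
next
  case (11 X Y)
  then show ?case by (simp add: deform_def expand fun_eq_iff)
qed (auto simp: M E I J skew_I skew_J anticommute metric_minus deform_def intro!: mems)

lemma anticommuting_pair_comp: "anticommuting_pair M E g \<Theta> I (\<lambda>x. I x \<circ> J x)"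
proof (unfold_locales, goal_cases)
  case 4
  show ?case by (rule tensor11_comp[OF M E I J])
next
  case 6
  have "g x (I x (J x u)) v + g x u (I x (J x v)) = 0" if "u \<in> fibre E x" "v \<in> fibre E x" for x u v
  proof -
    \<comment> \<open>Skew-symmetry of \<open>J\<close> at (Iu, v) and of \<open>I\<close> at (u,
      Jv) share the middle term g(Iu, Jv); eliminating it and replacing JI by -IJ gives
      skew-symmetry of IJ.\<close>
    have "g x (J x (I x u)) v + g x (I x u) (J x v) = 0" "g x (I x u) (J x v) + g x u (I x (J x v)) = 0"
      using that mems skew_I skew_J unfolding skew_symmetric_def by auto
    then show ?thesis
      using that by (simp add: anticommute metric_minus mems)
  qed
  then show ?case by (simp add: skew_symmetric_def)
qed (auto simp: M E I J skew_I expand metric_minus anchor_minus)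

end

text \<open>The invariant of both inductions, with compatibility expressed as D = 0.\<close>

locale torsion_compatible_pair = anticommuting_pair +
  assumes half_concomitant_zero:
      "X \<in> sections M E \<Longrightarrow> Y \<in> sections M E \<Longrightarrow> half_concomitant \<Theta> I J X Y = (\<lambda>x. 0)"
    and torsion_zero: "X \<in> sections M E \<Longrightarrow> Y \<in> sections M E \<Longrightarrow>
      torsion \<Theta> I (app J X) Y = (\<lambda>x. 0) \<and> torsion \<Theta> I X (app J Y) = (\<lambda>x. 0)"
begin

text \<open>Since -IJX = J(IX) and IX is again a section, the torsion hypothesis applies after a
  change of sign.\<close>

lemma torsion_app_I_J:
  assumes "X \<in> sections M E" "Y \<in> sections M E"
  shows "torsion \<Theta> I (app I (app J X)) Y x = 0" "torsion \<Theta> I X (app I (app J Y)) x = 0"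
proof -
  show "torsion \<Theta> I (app I (app J X)) Y x = 0"
    using torsion_minus(1)[of "app I (app J X)" Y x] torsion_zero[of "app I X" Y] assms
    by (simp add: app_mem app_anticommute[symmetric])
  show "torsion \<Theta> I X (app I (app J Y)) x = 0"
    using torsion_minus(2)[of X "app I (app J Y)" x] torsion_zero[of X "app I Y"] assms
    by (simp add: app_mem app_anticommute[symmetric])
qed

text \<open>In the deformed torsion at (JX, Y) the one term that the torsion hypothesis does not
  cover directly is T(IJX, Y), supplied by \<open>torsion_app_I_J\<close>; symmetrically in the
  second argument.\<close>

lemma torsion_compatible_pair_deform: "torsion_compatible_pair M E g (deform I \<Theta>) I J"
  by (rule torsion_compatible_pair.intro[OF anticommuting_pair_deform], unfold_locales)
    (auto simp: fun_eq_iff half_concomitant_deform half_concomitant_zero torsion_zero torsion_deform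
      torsion_app_I_J mems tensor_zero)

text \<open>For the new second tensor IJ the torsion condition is exactly
  \<open>torsion_app_I_J\<close>.\<close>

lemma torsion_compatible_pair_comp: "torsion_compatible_pair M E g \<Theta> I (\<lambda>x. I x \<circ> J x)"
  by (rule torsion_compatible_pair.intro[OF anticommuting_pair_comp], unfold_locales)
    (auto simp: fun_eq_iff half_concomitant_comp half_concomitant_zero torsion_zero app_comp
      torsion_app_I_J mems tensor_zero)

lemma concomitant_zero: "pc_is_zero M E (concomitant \<Theta> I J)"
  by (simp add: concomitant_zero_iff half_concomitant_zero)

lemma compatible: "compatible_pair M E g \<Theta> I J"
  using I J skew_I skew_J anticommute concomitant_zero unfolding compatible_pair_def by simp

end

section \<open>Iteration and conclusion\<close>

lemma torsion_compatible_pair_deform_funpow: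
  "torsion_compatible_pair M E g \<Theta> I J \<Longrightarrow> torsion_compatible_pair M E g ((deform I ^^ k) \<Theta>) I J"
  by (induction k) (auto intro: torsion_compatible_pair.torsion_compatible_pair_deform)

lemma torsion_compatible_pair_comp_funpow:
  assumes "torsion_compatible_pair M E g \<Theta> I J"
  shows "torsion_compatible_pair M E g \<Theta> I (\<lambda>x. (I x ^^ n) \<circ> J x)"
proof (induction n)
  case 0
  then show ?case using assms by (simp add: comp_def)
next
  case (Suc n)
  then show ?case
    \<comment> \<open>The composition step is applied with I^n J in the role of
      \<open>J\<close>.\<close>
    using torsion_compatible_pair.torsion_compatible_pair_comp[OF Suc] by (simp add: comp_def)
qed

theorem theorem2p18:
  fixes M :: "'m::{t2_space,second_countable_topology} manifold"
    and E :: "('m, 'e::real_vector) vbundle"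
    and g :: "'m \<Rightarrow> 'e \<Rightarrow> 'e \<Rightarrow> real"
    and \<Theta> :: "('m, 'e) pc_struct"
    and I J :: "'m \<Rightarrow> 'e \<Rightarrow> 'e"
  assumes "pre_courant_algebroid M E g \<Theta>"
    and "tensor11 M E I" and "skew_symmetric E g I"
    and "tensor11 M E J" and "skew_symmetric E g J"
    and "\<And>X Y. X \<in> sections M E \<Longrightarrow> Y \<in> sections M E \<Longrightarrow>
           torsion \<Theta> I (app J X) Y = (\<lambda>x. 0) \<and> torsion \<Theta> I X (app J Y) = (\<lambda>x. 0)"
    and "compatible_pair M E g \<Theta> I J"
  shows "\<forall>k n :: nat.
           pc_is_zero M E (concomitant ((deform I ^^ k) \<Theta>) I (\<lambda>x. (I x ^^ n) \<circ> J x)) \<and>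
           compatible_pair M E g ((deform I ^^ k) \<Theta>) I (\<lambda>x. (I x ^^ n) \<circ> J x)"
proof -
  have M: "smooth_manifold M" and E: "vector_bundle M E" and g: "bundle_metric M E g"
    and \<Theta>: "anchor_map M E (anchor \<Theta>)"
      "\<And>X Y. X \<in> sections M E \<Longrightarrow> Y \<in> sections M E \<Longrightarrow> bracket \<Theta> X Y \<in> sections M E"
    using assms(1) unfolding pre_courant_algebroid_def pre_courant_structure_def by blast+
  have lin: "bracket \<Theta> (\<lambda>x. a *\<^sub>R X x + b *\<^sub>R Y x) Z =
          (\<lambda>x. a *\<^sub>R bracket \<Theta> X Z x + b *\<^sub>R bracket \<Theta> Y Z x) \<and>
        bracket \<Theta> Z (\<lambda>x. a *\<^sub>R X x + b *\<^sub>R Y x) =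
          (\<lambda>x. a *\<^sub>R bracket \<Theta> Z X x + b *\<^sub>R bracket \<Theta> Z Y x)"
    if "X \<in> sections M E" "Y \<in> sections M E" "Z \<in> sections M E" for X Y Z a b
    using assms(1) that unfolding pre_courant_algebroid_def pre_courant_structure_def by blast
  interpret anticommuting_pair M E g \<Theta> I J
  proof (unfold_locales, goal_cases)
    case (7 u x)
    then show ?case using assms(7) unfolding compatible_pair_def by simp
  next
    case (8 u x v)
    \<comment> \<open>Linearity is given for combinations of two vectors, so negation is written as
      (-1)u + 0u, here and in the following cases.\<close>
    then have "g x ((- 1) *\<^sub>R u + 0 *\<^sub>R u) v = (- 1) * g x u v + 0 * g x u v"
      using g unfolding bundle_metric_def by blast
    then show ?case by simp
  next
    case (9 u x)
    then have "anchor \<Theta> x ((- 1) *\<^sub>R u + 0 *\<^sub>R u) = (\<lambda>f. (- 1) * anchor \<Theta> x u f + 0 * anchor \<Theta> x u f)"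
      using \<Theta>(1) unfolding anchor_map_def by blast
    then show ?case by simp
  next
    case (10 X Y x)
    then show ?case using \<Theta>(2) unfolding sections_def by blast
  next
    case (11 X Y)
    then show ?case using lin[of X X Y "- 1" 0] lin[of Y Y X "- 1" 0] by simp
  qed (use M E assms in auto)
  have "torsion_compatible_pair M E g \<Theta> I J"
    using assms(6,7) concomitant_zero_iff unfolding compatible_pair_def
    by unfold_locales auto
  \<comment> \<open>The structure is deformed \<open>k\<close> times with \<open>J\<close> fixed;
    then \<open>J\<close> is multiplied by \<open>I\<close> \<open>n\<close> times over the deformed
    structure.\<close>
  then have "torsion_compatible_pair M E g ((deform I ^^ k) \<Theta>) I (\<lambda>x. (I x ^^ n) \<circ> J x)" for k n
    by (intro torsion_compatible_pair_comp_funpow torsion_compatible_pair_deform_funpow)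
  then show ?thesis
    by (intro allI conjI torsion_compatible_pair.concomitant_zero torsion_compatible_pair.compatible)
qed

end
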